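(* (Catalan's identity) For $n,r\in\mathbb{N}$ such that $n\ge r$: 1. $m\mathbb{O}_{k,n+r}m\mathbb{O}_{k,n-r}-m\mathbb{O}_{k,n}^2=2^{n-r}\left[\alpha\beta(\lambda_1^{2r}-2^{r})+\beta\alpha(\lambda_2^{2r}-2^{r})\right]$; 2. $m\mathbb{O}_{k,n-r}m\mathbb{O}_{k,n+r}-m\mathbb{O}_{k,n}^2=2^{n-r}\left[\alpha\beta(\lambda_2^{2r}-2^{r})+\beta\alpha(\lambda_1^{2r}-2^{r})\right]$. Here $\alpha=\sum_{s=0}^{7}\lambda_1^{s}e_s$ and $\beta=\sum_{s=0}^{7}\lambda_2^{s}e_s$.
   Context: $\mathbb{N}$ is the set of positive integers. $\mathbb{O}$ denotes the octonions, the $8$-dimensional real (non-commutative, non-associative) algebra with basis $e_0=1,e_1,\dots,e_7$ and bilinear multiplication determined by: $e_0$ is the identity, $e_a^2=-1$ for $a\ge1$, $e_ae_b=-e_be_a$ for distinct $a,b\ge1$, and $e_ae_b=e_c$, $e_be_c=e_a$, $e_ce_a=e_b$ for $(a,b,c)\in\{(1,2,3),(1,4,5),(1,7,6),(2,4,6),(2,5,7),(3,4,7),(3,6,5)\}$. For a parameter $k$, the $k$-Mersenne-Lucas numbers are defined by $m_{k,0}=2$, $m_{k,1}=3k$, $m_{k,n+1}=3km_{k,n}-2m_{k,n-1}$ for $n\ge1$. The $n$-th $k$-Mersenne-Lucas octonion is $m\mathbb{O}_{k,n}=\sum_{s=0}^{7}m_{k,n+s}e_s$ for $n\ge 0$.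 The numbers $\lambda_1=\frac{3k+\sqrt{9k^2-8}}{2}$ and $\lambda_2=\frac{3k-\sqrt{9k^2-8}}{2}$ are the roots of $\lambda^2-3k\lambda+2=0$. *)

theory Defs
  imports Complex_Main
begin

typedef octonion = "{x :: nat \<Rightarrow> real. \<forall>i\<ge>8. x i = 0}"
  morphisms oct_coord Octonion
  by (rule exI[of _ "\<lambda>_. 0"]) simp

setup_lifting type_definition_octonion

instantiation octonion :: real_vector
begin

lift_definition zero_octonion :: octonion is "\<lambda>_. 0" by simp
lift_definition plus_octonion :: "octonion \<Rightarrow> octonion \<Rightarrow> octonion"
  is "\<lambda>x y i. x i + y i" by simp
lift_definition minus_octonion :: "octonion \<Rightarrow> octonion \<Rightarrow> octonion"
  is "\<lambda>x y i. x i - y i" by simp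
lift_definition uminus_octonion :: "octonion \<Rightarrow> octonion"
  is "\<lambda>x i. - x i" by simp
lift_definition scaleR_octonion :: "real \<Rightarrow> octonion \<Rightarrow> octonion"
  is "\<lambda>c x i. c * x i" by simp

instance
  by standard (transfer; simp add: fun_eq_iff algebra_simps)+

end

lift_definition oct_basis :: "nat \<Rightarrow> octonion"
  is "\<lambda>s i. if i = s \<and> s < 8 then 1 else 0" by auto

definition oct_triples :: "(nat \<times> nat \<times> nat) set" where
  "oct_triples = {(1,2,3), (1,4,5), (1,7,6), (2,4,6), (2,5,7), (3,4,7), (3,6,5)}"

definition oct_cyclic :: "nat \<Rightarrow> nat \<Rightarrow> nat \<Rightarrow> bool" where
  "oct_cyclic a b c \<longleftrightarrow>
     (a, b, c) \<in> oct_triples \<or> (b, c, a) \<in> oct_triples \<or> (c, a, b) \<in> oct_triples"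

text \<open>The structure constant \<open>oct_const a b c\<close> is the coefficient of
  \<open>oct_basis c\<close> in the product \<open>oct_basis a * oct_basis b\<close>.\<close>

definition oct_const :: "nat \<Rightarrow> nat \<Rightarrow> nat \<Rightarrow> real" where
  "oct_const a b c =
     (if a = 0 then (if c = b then 1 else 0)
      else if b = 0 then (if c = a then 1 else 0)
      else if a = b then (if c = 0 then - 1 else 0)
      else if oct_cyclic a b c then 1
      else if oct_cyclic b a c then - 1
      else 0)"

text \<open>Octonion multiplication is not associative, so \<open>octonion\<close> is an instance of
  \<open>times\<close> but not of \<open>semigroup_mult\<close>; the class \<open>power\<close> makes \<open>x\<^sup>2\<close>
  available, with \<open>x\<^sup>2 = x * x\<close> proved below.\<close>

instantiation octonion :: "{one, times, power}"
begin

definition one_octonion :: octonion where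
  "one_octonion = oct_basis 0"

lift_definition times_octonion :: "octonion \<Rightarrow> octonion \<Rightarrow> octonion"
  is "\<lambda>x y c. \<Sum>a<8. \<Sum>b<8. x a * y b * oct_const a b c"
  by (auto simp: oct_const_def oct_cyclic_def oct_triples_def intro!: sum.neutral)

instance ..

end

lemma oct_basis_mult_coord:
  assumes "a < 8" "b < 8"
  shows "oct_coord (oct_basis a * oct_basis b) = oct_const a b"
proof
  fix c
  have "oct_coord (oct_basis a * oct_basis b) c =
        (\<Sum>i<8. \<Sum>j<8. (if i = a then (if j = b then oct_const i j c else 0) else 0))"
    unfolding times_octonion.rep_eq oct_basis.rep_eq using assms
    by (intro sum.cong) auto
  also have "\<dots> = (\<Sum>i<8. if i = a then (\<Sum>j<8. if j = b then oct_const i j c else 0) else 0)"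
    by (intro sum.cong) auto
  also have "\<dots> = oct_const a b c"
    using assms by simp
  finally show "oct_coord (oct_basis a * oct_basis b) c = oct_const a b c" .
qed

lemma oct_scaleR_mult_left: "(c *\<^sub>R x) * y = c *\<^sub>R (x * y)" for x y :: octonion
  by transfer (simp add: fun_eq_iff sum_distrib_left algebra_simps)

lemma oct_scaleR_mult_right: "x * (c *\<^sub>R y) = c *\<^sub>R (x * y)" for x y :: octonion
  by transfer (simp add: fun_eq_iff sum_distrib_left algebra_simps)

lemma oct_distrib_right: "(x + y) * z = x * z + y * z" for x y z :: octonion
  by transfer (simp add: fun_eq_iff sum.distrib algebra_simps)

lemma oct_distrib_left: "x * (y + z) = x * y + x * z" for x y z :: octonion
  by transfer (simp add: fun_eq_iff sum.distrib algebra_simps)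

lemma oct_one_left: "1 * x = x" for x :: octonion
proof -
  have "oct_coord (1 * x) c = oct_coord x c" for c
  proof -
    have "oct_coord (1 * x) c =
        (\<Sum>a<8::nat. if a = 0 then \<Sum>b<8. if b = c then oct_coord x b else 0 else 0)"
      unfolding one_octonion_def times_octonion.rep_eq oct_basis.rep_eq
      by (intro sum.cong refl) (auto simp: oct_const_def if_distrib[where f = "\<lambda>z. _ * z"] cong: if_cong)
    also have "\<dots> = oct_coord x c"
      using oct_coord[of x] by simp
    finally show ?thesis .
  qed
  then show ?thesis
    by (simp add: oct_coord_inject[symmetric] fun_eq_iff)
qed

lemma oct_one_right: "x * 1 = x" for x :: octonion
proof -
  have "oct_coord (x * 1) c = oct_coord x c" for c
  proof -
    have "oct_coord (x * 1) c =
        (\<Sum>a<8. \<Sum>b<8::nat. if b = 0 then (if a = c then oct_coord x a else 0) else 0)"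
      unfolding one_octonion_def times_octonion.rep_eq oct_basis.rep_eq
      by (intro sum.cong refl) (auto simp: oct_const_def)
    also have "\<dots> = oct_coord x c"
      using oct_coord[of x] by simp
    finally show ?thesis .
  qed
  then show ?thesis
    by (simp add: oct_coord_inject[symmetric] fun_eq_iff)
qed

lemma oct_power2: "x\<^sup>2 = x * x" for x :: octonion
  by (simp add: numeral_2_eq_2 power.simps oct_one_right)

lemma oct_basis_square:
  assumes "1 \<le> a" "a < 8"
  shows "oct_basis a * oct_basis a = - 1"
  using oct_basis_mult_coord[of a a] assms
  by (auto simp: oct_coord_inject[symmetric] fun_eq_iff oct_const_def one_octonion_def
      uminus_octonion.rep_eq oct_basis.rep_eq)

lemma oct_cyclic_asym: "oct_cyclic a b c \<Longrightarrow> \<not> oct_cyclic b a c"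
  unfolding oct_cyclic_def oct_triples_def by (elim disjE insertE) simp_all

lemma oct_basis_anticommute:
  assumes "1 \<le> a" "a < 8" "1 \<le> b" "b < 8" "a \<noteq> b"
  shows "oct_basis a * oct_basis b = - (oct_basis b * oct_basis a)"
proof -
  have "oct_const a b c = - oct_const b a c" for c
    using assms oct_cyclic_asym[of a b c] by (simp add: oct_const_def)
  then show ?thesis
    using assms by (simp add: oct_coord_inject[symmetric] fun_eq_iff oct_basis_mult_coord
        uminus_octonion.rep_eq)
qed

lemma oct_triples_less: "(a, b, c) \<in> oct_triples \<Longrightarrow> a < 8 \<and> b < 8 \<and> c < 8"
  unfolding oct_triples_def by auto

lemma oct_const_cyclic:
  assumes "oct_cyclic a b c"
  shows "oct_const a b = (\<lambda>d. if d = c then 1 else 0)"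
proof -
  have ab: "a \<noteq> 0" "b \<noteq> 0" "a \<noteq> b"
    using assms unfolding oct_cyclic_def oct_triples_def by auto
  have "oct_cyclic a b d \<longleftrightarrow> d = c" "\<not> oct_cyclic b a d" for d
    using assms unfolding oct_cyclic_def oct_triples_def
    by (elim disjE insertE; simp)+
  with ab show ?thesis
    by (simp add: oct_const_def fun_eq_iff)
qed

lemma oct_basis_triple:
  assumes "(a, b, c) \<in> oct_triples"
  shows "oct_basis a * oct_basis b = oct_basis c"
    and "oct_basis b * oct_basis c = oct_basis a"
    and "oct_basis c * oct_basis a = oct_basis b"
proof -
  have "oct_cyclic a b c" "oct_cyclic b c a" "oct_cyclic c a b"
    using assms by (auto simp: oct_cyclic_def)
  with oct_triples_less[OF assms] show
    "oct_basis a * oct_basis b = oct_basis c"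
    "oct_basis b * oct_basis c = oct_basis a"
    "oct_basis c * oct_basis a = oct_basis b"
    by (simp_all add: oct_coord_inject[symmetric] fun_eq_iff oct_basis_mult_coord
        oct_const_cyclic oct_basis.rep_eq)
qed

fun mersenne_lucas :: "real \<Rightarrow> nat \<Rightarrow> real" where
  "mersenne_lucas k 0 = 2"
| "mersenne_lucas k (Suc 0) = 3 * k"
| "mersenne_lucas k (Suc (Suc n)) = 3 * k * mersenne_lucas k (Suc n) - 2 * mersenne_lucas k n"

definition mersenne_lucas_oct :: "real \<Rightarrow> nat \<Rightarrow> octonion" where
  "mersenne_lucas_oct k n = (\<Sum>s=0..7. mersenne_lucas k (n + s) *\<^sub>R oct_basis s)"

text \<open>The two roots are real only if \<open>9 * k\<^sup>2 \<ge> 8\<close>; the real \<open>sqrt\<close> of a negative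
  number is not a square root of it.\<close>

definition ml_root1 :: "real \<Rightarrow> real" where
  "ml_root1 k = (3 * k + sqrt (9 * k\<^sup>2 - 8)) / 2"

definition ml_root2 :: "real \<Rightarrow> real" where
  "ml_root2 k = (3 * k - sqrt (9 * k\<^sup>2 - 8)) / 2"

definition ml_alpha :: "real \<Rightarrow> octonion" where
  "ml_alpha k = (\<Sum>s=0..7. (ml_root1 k) ^ s *\<^sub>R oct_basis s)"

definition ml_beta :: "real \<Rightarrow> octonion" where
  "ml_beta k = (\<Sum>s=0..7. (ml_root2 k) ^ s *\<^sub>R oct_basis s)"

end

theory Submission
  imports Defs
begin

text \<open>
  Once \<open>9 k\<^sup>2 \<ge> 8\<close>, the roots \<open>\<lambda>\<^sub>1\<close>, \<open>\<lambda>\<^sub>2\<close> of \<open>\<lambda>\<^sup>2 - 3 k \<lambda> + 2\<close> are real, with sum \<open>3 k\<close> and product \<open>2\<close>, so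
  the sequence has the Binet form \<open>\<lambda>\<^sub>1\<^sup>n + \<lambda>\<^sub>2\<^sup>n\<close>, and summing this against the basis gives
  \<open>\<lambda>\<^sub>1\<^sup>n \<alpha> + \<lambda>\<^sub>2\<^sup>n \<beta>\<close> for the octonions (lemma \<open>mersenne_lucas_oct_Binet\<close>). Catalan's identity is then
  a consequence of the bilinearity of the product: in a product of
  the members with indices \<open>n + r\<close> and \<open>n - r\<close> the coefficients of \<open>\<alpha> \<alpha>\<close> and \<open>\<beta> \<beta>\<close> depend on the sum of the
  indices alone, so they cancel against those of the square, and only \<open>\<alpha> \<beta>\<close> and \<open>\<beta> \<alpha>\<close> survive
  (lemma \<open>oct_Binet_mult_diff_square\<close>). Their coefficients simplify by \<open>\<lambda>\<^sub>1 \<lambda>\<^sub>2 = 2\<close>. Interchanging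
  the two factors exchanges the roles of \<open>\<lambda>\<^sub>1\<close> and \<open>\<lambda>\<^sub>2\<close> in these coefficients, which gives the second
  identity.
\<close>

lemma ml_root_sum: "ml_root1 k + ml_root2 k = 3 * k"
  by (simp add: ml_root1_def ml_root2_def field_simps)

lemma ml_root_prod:
  assumes "9 * k\<^sup>2 \<ge> 8"
  shows "ml_root1 k * ml_root2 k = 2"
proof -
  have "ml_root1 k * ml_root2 k = ((3 * k)\<^sup>2 - (sqrt (9 * k\<^sup>2 - 8))\<^sup>2) / 4"
    by (simp add: ml_root1_def ml_root2_def power2_eq_square algebra_simps)
  also have "\<dots> = 2"
    using assms by (simp add: power_mult_distrib)
  finally show ?thesis .
qed

lemma mersenne_lucas_Binet:
  assumes "9 * k\<^sup>2 \<ge> 8"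
  shows "mersenne_lucas k n = ml_root1 k ^ n + ml_root2 k ^ n"
proof (induction n rule: induct_nat_012)
  case 0
  then show ?case by simp
next
  case 1
  then show ?case by (simp add: ml_root_sum)
next
  case (ge2 n)
  \<comment> \<open>Vieta's formulas turn the recurrence into one that every combination of powers of
    \<open>a\<close> and \<open>b\<close> satisfies.\<close>
  define a b where "a = ml_root1 k" and "b = ml_root2 k"
  have "mersenne_lucas k (Suc (Suc n)) = (a + b) * (a ^ Suc n + b ^ Suc n) - (a * b) * (a ^ n + b ^ n)"
    using ge2 ml_root_sum[of k] ml_root_prod[OF assms] by (simp add: a_def b_def)
  then show ?case
    by (simp add: a_def b_def algebra_simps)
qed

lemma mersenne_lucas_oct_Binet:
  assumes "9 * k\<^sup>2 \<ge> 8"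
  shows "mersenne_lucas_oct k n = ml_root1 k ^ n *\<^sub>R ml_alpha k + ml_root2 k ^ n *\<^sub>R ml_beta k"
  by (simp add: mersenne_lucas_oct_def ml_alpha_def ml_beta_def mersenne_lucas_Binet[OF assms]
      power_add scaleR_add_left scaleR_sum_right sum.distrib)

text \<open>
  The terms in \<open>u u\<close> and \<open>v v\<close> have coefficients \<open>a\<^sup>i\<^sup>+\<^sup>j\<close> and \<open>b\<^sup>i\<^sup>+\<^sup>j\<close>, which the square at the mean index \<open>n\<close>
  reproduces. As \<open>i\<close> and \<open>j\<close> enter symmetrically, this covers both orders of the factors in
  Catalan's identity.
\<close>

lemma oct_Binet_mult_diff_square:
  fixes u v :: octonion
  assumes "i + j = 2 * n"
  shows "(a ^ i *\<^sub>R u + b ^ i *\<^sub>R v) * (a ^ j *\<^sub>R u + b ^ j *\<^sub>R v) - (a ^ n *\<^sub>R u + b ^ n *\<^sub>R v)\<^sup>2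
    = (a ^ i * b ^ j - (a * b) ^ n) *\<^sub>R (u * v) + (b ^ i * a ^ j - (a * b) ^ n) *\<^sub>R (v * u)"
proof -
  have expand: "(c *\<^sub>R u + d *\<^sub>R v) * (c' *\<^sub>R u + d' *\<^sub>R v)
      = (c * c') *\<^sub>R (u * u) + (c * d') *\<^sub>R (u * v) + (d * c') *\<^sub>R (v * u) + (d * d') *\<^sub>R (v * v)"
    for c d c' d' :: real
    by (simp add: oct_distrib_left oct_distrib_right oct_scaleR_mult_left oct_scaleR_mult_right
        scaleR_add_right mult.commute)
  have diagonal: "x ^ i * x ^ j = x ^ n * x ^ n" for x :: real
    using assms by (simp flip: power_add add: mult_2)
  show ?thesis
    unfolding oct_power2 expand diagonal
    by (simp add: power_mult_distrib scaleR_diff_left mult.commute algebra_simps)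
qed

lemma cross_power_diff:
  fixes a b :: "'a :: comm_ring_1"
  assumes "r \<le> n"
  shows "a ^ (n + r) * b ^ (n - r) - (a * b) ^ n = (a * b) ^ (n - r) * (a ^ (2 * r) - (a * b) ^ r)"
proof -
  obtain d where "n = d + r"
    using assms by (metis le_add_diff_inverse2)
  then show ?thesis
    by (simp add: power_add power_mult_distrib mult_2_right algebra_simps)
qed

theorem theorem3p3:
  fixes k :: real and n r :: nat
  assumes "9 * k\<^sup>2 \<ge> 8"
    and "1 \<le> n" and "1 \<le> r" and "r \<le> n"
  shows "mersenne_lucas_oct k (n + r) * mersenne_lucas_oct k (n - r) - (mersenne_lucas_oct k n)\<^sup>2
      = 2 ^ (n - r) *\<^sub>R
          (((ml_root1 k) ^ (2 * r) - 2 ^ r) *\<^sub>R (ml_alpha k * ml_beta k)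
         + ((ml_root2 k) ^ (2 * r) - 2 ^ r) *\<^sub>R (ml_beta k * ml_alpha k))
    \<and> mersenne_lucas_oct k (n - r) * mersenne_lucas_oct k (n + r) - (mersenne_lucas_oct k n)\<^sup>2
      = 2 ^ (n - r) *\<^sub>R
          (((ml_root2 k) ^ (2 * r) - 2 ^ r) *\<^sub>R (ml_alpha k * ml_beta k)
         + ((ml_root1 k) ^ (2 * r) - 2 ^ r) *\<^sub>R (ml_beta k * ml_alpha k))"
proof -
  define a b where "a = ml_root1 k" and "b = ml_root2 k"
  have ab: "a * b = 2" "b * a = 2"
    using ml_root_prod[OF assms(1)] by (simp_all add: a_def b_def mult.commute)
  have coeff_a: "a ^ (n + r) * b ^ (n - r) - 2 ^ n = 2 ^ (n - r) * (a ^ (2 * r) - 2 ^ r)"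
    using cross_power_diff[OF assms(4), of a b] by (simp only: ab)
  have coeff_b: "b ^ (n + r) * a ^ (n - r) - 2 ^ n = 2 ^ (n - r) * (b ^ (2 * r) - 2 ^ r)"
    using cross_power_diff[OF assms(4), of b a] by (simp only: ab)
  have indices: "n + r + (n - r) = 2 * n" "n - r + (n + r) = 2 * n"
    using assms(4) by simp_all
  note long_first = oct_Binet_mult_diff_square[OF indices(1), where a = a and b = b]
    and short_first = oct_Binet_mult_diff_square[OF indices(2), where a = a and b = b]
  show ?thesis
    unfolding mersenne_lucas_oct_Binet[OF assms(1)] a_def[symmetric] b_def[symmetric]
      long_first short_first ab
    by (simp add: coeff_a coeff_b mult.commute[of "_ ^ (n - r)" "_ ^ (n + r)"] scaleR_add_right)
qed

end
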